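(* For any integers $1\le n\le m$, we have $r_{m,n}\le -\xi/2$, where $\xi$ is the unique negative solution of the polynomial equation $$\mathcal{L}^{(-m-1)}_{n}(x)-\binom{m}{n}=0 .$$ Moreover, $-\xi/2\le m-\frac12\left(1+(-1)^n\right)$.
   Context: For integers $0\le n\le m$, $\Pi_{m,n}$ is the class of polynomials $P(z)=\sum_{k=0}^m \alpha_k \frac{z^k}{k!}$ with $\alpha_0=\alpha_1=\dots=\alpha_n=1$ (the coefficients $\alpha_k$, $k>n$, being arbitrary complex numbers). The stability region of $P$ is $S_P=\{z\in\mathbb{C} : |P(z)|\le 1\}$, and $D_r=\{z\in\mathbb{C} : |z+r|\le r\}$ for real $r\ge 0$. For $P\in\Pi_{m,n}$ set $r(P)=\sup\{r : D_r\subset S_P\}$; the absolute stability radius is $r_{m,n}=\sup\{r(P) : P\in\Pi_{m,n}\}$. For any real $\gamma$ (including negative values), the generalized Laguerre polynomial is defined by $\mathcal{L}_n^{(\gamma)}(x)=\sum_{\ell=0}^n\binom{n+\gamma}{n-\ell}\frac{(-x)^\ell}{\ell!}$, where $\binom{t}{\ell}=\frac{t(t-1)\cdots(t-\ell+1)}{\ell!}$ for $\ell>0$ and $\binom{t}{0}=1$. *)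

theory Defs
  imports Complex_Main "HOL-Library.Extended_Real" "HOL-Computational_Algebra.Polynomial"
begin

definition Pi_class :: "nat \<Rightarrow> nat \<Rightarrow> complex poly set" where
  "Pi_class m n =
     {P. \<exists>\<alpha> :: nat \<Rightarrow> complex. (\<forall>k\<le>n. \<alpha> k = 1) \<and> P = (\<Sum>k\<le>m. monom (\<alpha> k / fact k) k)}"

definition stability_region :: "complex poly \<Rightarrow> complex set" where
  "stability_region P = {z. cmod (poly P z) \<le> 1}"

definition stability_disk :: "real \<Rightarrow> complex set" where
  "stability_disk r = {z. cmod (z + complex_of_real r) \<le> r}"

(* Both suprema are taken in the extended reals, so that a finite upper bound on them
   really asserts boundedness of the underlying set (Sup on type real is unspecified
   for unbounded sets).  The restriction 0 \<le> r excludes the empty disks. *)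
definition stability_radius :: "complex poly \<Rightarrow> ereal" where
  "stability_radius P = (SUP r\<in>{r. 0 \<le> r \<and> stability_disk r \<subseteq> stability_region P}. ereal r)"

definition abs_stability_radius :: "nat \<Rightarrow> nat \<Rightarrow> ereal" where
  "abs_stability_radius m n = (SUP P\<in>Pi_class m n. stability_radius P)"

definition gen_laguerre :: "nat \<Rightarrow> real \<Rightarrow> real \<Rightarrow> real" where
  "gen_laguerre n \<gamma> x = (\<Sum>l\<le>n. ((real n + \<gamma>) gchoose (n - l)) * ((- x) ^ l / fact l))"

end

theory Submission
  imports Defs "HOL-Computational_Algebra.Fundamental_Theorem_Algebra"
begin

text \<open>
  Write \<open>a = m - n\<close>, and let \<open>\<Lambda>\<close> be the linear functional on real polynomials with
  \<open>\<Lambda>(t\<^sup>k) = k!\<close>, that is, integration against \<open>exp (- t)\<close> over the half-line. Up to the factor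
  \<open>n! a!\<close>, the Laguerre polynomial at \<open>- y\<close> is
  \<open>F(y) = \<Lambda>(t\<^sup>a (y - t)\<^sup>n)\<close>, and the binomial coefficient is \<open>\<Lambda>(t\<^sup>a t\<^sup>n) = m!\<close>.
  So \<open>\<xi> = - y\<close> is a solution iff \<open>F(y) = m!\<close>. Three facts about \<open>F\<close> are combined.

  \<^item> If \<open>D\<^sub>r\<close> lies in the stability region of some \<open>P\<close> of the class, then \<open>F(2r) \<le> m!\<close>
    (\<open>shifted_moment_le_fact_if_stable\<close>). The polar form (blossom) of a polynomial of degree at most
    \<open>m\<close> that is bounded by 1 on a disk is again bounded by 1 when its \<open>m\<close> arguments lie in the disk;
    this is an instance of the Grace-Walsh-Szego coincidence theorem. With \<open>n\<close> arguments
    \<open>- 2r\<close> and \<open>m - n\<close> arguments 0, both on the boundary of \<open>D\<^sub>r\<close>, the blossom depends only on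
    the coefficients of index at most \<open>n\<close>, which are prescribed, and it equals
    \<open>\<plusminus> F(2r) / m!\<close>. The coincidence theorem is replaced by \<open>n\<close> applications of
    Laguerre's theorem on the polar derivative.

  \<^item> Once \<open>F\<close> has reached \<open>m!\<close> at a positive point, it stays above \<open>m!\<close>
    (\<open>shifted_moment_gt_beyond\<close>): \<open>\<Lambda>\<close> is positive on polynomials that are nonnegative on the
    half-line, so \<open>F'\<close> is positive for odd \<open>n\<close>, while for even \<open>n\<close> the function \<open>F\<close> is strictly
    convex with \<open>F(0) = m!\<close>. Hence the positive solution \<open>y\<close> is unique, and \<open>F(2r) \<le> m!\<close>
    forces \<open>2r \<le> y\<close>.

  \<^item> \<open>F(2M) \<ge> m!\<close> for \<open>M = m\<close> (\<open>n\<close> odd) or \<open>M = m - 1\<close> (\<open>n\<close> even)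
    (\<open>shifted_moment_ge_fact\<close>). With \<open>t = M + s\<close> one compares \<open>(M - s)\<^sup>n\<close> and \<open>(M + s)\<^sup>n\<close>, and
    the difference is governed by the odd moments \<open>\<Lambda>(t\<^sup>a s\<^sup>j)\<close>, which are nonpositive by a recurrence
    that comes from integration by parts. This gives both the existence of \<open>y\<close> and \<open>y \<le> 2M\<close>.
\<close>

section \<open>Polar derivatives of polynomials bounded on a disk\<close>

lemma in_tangent_disk_iff:
  fixes Z :: complex and r :: real
  assumes "0 < r"
  shows "cmod (Z - of_real r) \<le> r \<longleftrightarrow> (cmod Z)\<^sup>2 \<le> 2 * r * Re Z"
proof -
  have "(cmod (Z - of_real r))\<^sup>2 = (cmod Z)\<^sup>2 - 2 * r * Re Z + r\<^sup>2"
    by (simp add: cmod_power2 power2_diff)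
  then show ?thesis
    using assms power_mono_iff[of "cmod (Z - of_real r)" r 2] by simp
qed

text \<open>
  The number in question is the reciprocal of \<open>1/Z - 1/W\<close>. Inversion maps the closed disk tangent to the
  imaginary axis at 0 onto the half-plane with real part at least \<open>1/(2r)\<close>, and the exterior
  of the disk into the complementary half-plane.
\<close>
lemma Re_mult_divide_diff_pos:
  fixes Z W :: complex and r :: real
  assumes r: "0 < r" and Z: "cmod (Z - of_real r) \<le> r" "Z \<noteq> 0" and W: "r < cmod (W - of_real r)"
  shows "0 < Re (Z * W / (W - Z))"
proof -
  have Zle: "(cmod Z)\<^sup>2 \<le> 2 * r * Re Z" and Wgt: "2 * r * Re W < (cmod W)\<^sup>2"
    using in_tangent_disk_iff[OF r] Z(1) W by (simp_all flip: not_le)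
  have "0 < (cmod Z)\<^sup>2 * ((cmod W)\<^sup>2 - 2 * r * Re W)"
    using Z(2) Wgt by simp
  also have "\<dots> \<le> 2 * r * (Re Z * (cmod W)\<^sup>2 - Re W * (cmod Z)\<^sup>2)"
    using mult_right_mono[OF Zle, of "(cmod W)\<^sup>2"] by (simp add: algebra_simps)
  finally have "0 < Re Z * (cmod W)\<^sup>2 - Re W * (cmod Z)\<^sup>2"
    using r by (simp add: zero_less_mult_iff)
  also have "\<dots> = Re (Z * W * cnj (W - Z))"
    unfolding cmod_power2 by (simp add: algebra_simps power2_eq_square)
  finally have num: "0 < Re (Z * W * cnj (W - Z))" .
  then have "W - Z \<noteq> 0" by auto
  then have "0 < (cmod (W - Z))\<^sup>2" by simp
  then show ?thesis
    unfolding complex_div_cnj[of "Z * W" "W - Z"] using num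
    by (simp add: complex_norm_square[symmetric] flip: of_real_power)
qed

text \<open>
  This is the core of Laguerre's theorem on polar derivatives. Each root \<open>w\<close> contributes
  \<open>1/(z - w)\<close> to the logarithmic derivative, hence \<open>Z - Z\<^sup>2/(z - w) = Z W/(W - Z)\<close> with
  \<open>W = w + 2r\<close> to the whole expression, which has positive real part because \<open>z\<close> lies in the disk
  and \<open>w\<close> outside. Each missing root, if the degree is less than \<open>k\<close>, contributes \<open>Z\<close>, which
  also has positive real part.
\<close>
lemma Re_log_derivative_bound:
  fixes P :: "complex poly" and z :: complex and r :: real
  assumes r: "0 < r" and z: "cmod (z + of_real r) \<le> r" "z \<noteq> - of_real (2 * r)"
    and "degree P \<le> k" and "P \<noteq> 0" and "\<And>w. poly P w = 0 \<Longrightarrow> r < cmod (w + of_real r)"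
  defines "Z \<equiv> z + of_real (2 * r)"
  shows "0 \<le> Re (Z * (of_nat k - Z * (poly (pderiv P) z / poly P z)))
    \<and> (0 < k \<longrightarrow> 0 < Re (Z * (of_nat k - Z * (poly (pderiv P) z / poly P z))))"
  using assms(4-6)
proof (induction k arbitrary: P)
  case 0
  then show ?case by (simp add: pderiv_eq_0_iff[THEN iffD2])
next
  case (Suc k)
  have Zdisk: "cmod (Z - of_real r) \<le> r"
    using z(1) by (simp add: Z_def algebra_simps)
  have Z0: "Z \<noteq> 0"
    using z(2) unfolding Z_def by (simp only: eq_neg_iff_add_eq_0 not_False_eq_True)
  have ReZ: "0 < Re Z"
  proof -
    have "(cmod Z)\<^sup>2 \<le> 2 * r * Re Z"
      using Zdisk in_tangent_disk_iff[OF r] by simp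
    moreover have "0 < (cmod Z)\<^sup>2" using Z0 by simp
    ultimately have "0 < 2 * r * Re Z" by linarith
    then show ?thesis using r by (simp add: zero_less_mult_iff)
  qed
  show ?case
  proof (cases "degree P = 0")
    case True
    then have "pderiv P = 0" by (simp add: pderiv_eq_0_iff)
    moreover have "0 < Re Z * (1 + real k)"
      using ReZ by simp
    ultimately show ?thesis by simp
  next
    case False
    then obtain w where w: "poly P w = 0"
      using fundamental_theorem_of_algebra[of P] by (auto simp: constant_degree)
    then obtain Q where Q: "P = [:-w, 1:] * Q"
      by (metis poly_eq_0_iff_dvd dvdE)
    have Qnz: "Q \<noteq> 0" using Suc.prems(2) Q by auto
    have "degree P = Suc (degree Q)"
      using Qnz unfolding Q by (subst degree_mult_eq) auto
    then have "degree Q \<le> k" using Suc.prems(1) by simp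
    moreover have "r < cmod (v + of_real r)" if "poly Q v = 0" for v
      using Suc.prems(3)[of v] that by (simp add: Q)
    ultimately have IH: "0 \<le> Re (Z * (of_nat k - Z * (poly (pderiv Q) z / poly Q z)))"
      using Suc.IH[of Q] Qnz by blast
    define W where "W = w + of_real (2 * r)"
    have Wout: "r < cmod (W - of_real r)"
      using Suc.prems(3)[OF w] by (simp add: W_def algebra_simps)
    have Pz: "poly P z \<noteq> 0"
      using Suc.prems(3)[of z] z(1) by force
    then have zw: "z - w \<noteq> 0" and Qz: "poly Q z \<noteq> 0"
      by (auto simp: Q)
    have pP: "poly (pderiv P) z = poly Q z + (z - w) * poly (pderiv Q) z"
      unfolding Q pderiv_mult by (simp add: pderiv_pCons algebra_simps)
    have pP0: "poly P z = (z - w) * poly Q z"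
      unfolding Q by (simp add: algebra_simps)
    have "poly (pderiv P) z / poly P z = 1 / (z - w) + poly (pderiv Q) z / poly Q z"
      unfolding pP pP0 using zw Qz by (simp add: add_divide_distrib)
    moreover have "Z - Z * Z * (1 / (z - w)) = Z * W / (W - Z)"
    proof -
      define u where "u = z - w"
      have W: "W = Z - u" and "u \<noteq> 0"
        using zw by (simp_all add: W_def Z_def u_def)
      then show ?thesis unfolding u_def[symmetric] W by (simp add: field_simps)
    qed
    ultimately have "Z * (of_nat (Suc k) - Z * (poly (pderiv P) z / poly P z))
        = Z * W / (W - Z) + Z * (of_nat k - Z * (poly (pderiv Q) z / poly Q z))"
      by (simp add: algebra_simps)
    then show ?thesis
      using Re_mult_divide_diff_pos[OF r Zdisk Z0 Wout] IH by simp
  qed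
qed

text \<open>
  If the polar derivative took a value \<open>c\<close> of modulus greater than 1, then \<open>P - c\<close> would have
  no root in the disk although its polar derivative vanishes at a point there, which Laguerre's
  theorem excludes.
\<close>
lemma polar_derivative_bounded:
  fixes P :: "complex poly" and r :: real
  assumes r: "0 < r" and deg: "degree P \<le> m" and m: "0 < m"
    and bound: "\<And>w. cmod (w + of_real r) \<le> r \<Longrightarrow> cmod (poly P w) \<le> 1"
    and z: "cmod (z + of_real r) \<le> r"
  shows "cmod (poly P z - (z + of_real (2 * r)) * poly (pderiv P) z / of_nat m) \<le> 1"
proof (cases "z = - of_real (2 * r)")
  case True
  then show ?thesis using bound[OF z] by simp
next
  case False
  define Z where "Z = z + of_real (2 * r)"
  define c where "c = poly P z - Z * poly (pderiv P) z / of_nat m"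
  have "cmod c \<le> 1"
  proof (rule ccontr)
    assume c: "\<not> cmod c \<le> 1"
    define R where "R = P - [:c:]"
    have out: "r < cmod (w + of_real r)" if "poly R w = 0" for w
      using that c bound[of w] by (force simp: R_def)
    have R0: "R \<noteq> 0" using out[of z] z by force
    have degR: "degree R \<le> m"
      unfolding R_def using deg by (intro degree_diff_le) auto
    have dR: "pderiv R = pderiv P" by (simp add: R_def pderiv_diff pderiv_pCons)
    have Rz: "poly R z \<noteq> 0" using out[of z] z by force
    have "poly R z = Z * poly (pderiv R) z / of_nat m"
      unfolding dR by (simp add: R_def c_def)
    then have "of_nat m - Z * (poly (pderiv R) z / poly R z) = 0"
      using Rz m by (simp add: field_simps)
    then show False
      using Re_log_derivative_bound[OF r z False degR R0 out, folded Z_def] m by simp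
  qed
  then show ?thesis unfolding c_def Z_def .
qed

text \<open>
  Divided by \<open>m!\<close>, the sum is the polar form of \<open>P\<close>, as a polynomial of degree at most \<open>m\<close>, at
  \<open>n\<close> copies of \<open>- 2r\<close> and \<open>m - n\<close> copies of 0. Each polar derivative with pole \<open>- 2r\<close> fixes one
  argument, lowers the degree bound by one and preserves the bound on the disk; the value at 0
  remains after \<open>n\<close> of them.
\<close>
lemma blossom_bounded:
  fixes P :: "complex poly" and r :: real
  assumes r: "0 < r" and "n \<le> m" and "degree P \<le> m"
    and "\<And>w. cmod (w + of_real r) \<le> r \<Longrightarrow> cmod (poly P w) \<le> 1"
  shows "cmod (\<Sum>l\<le>n. of_nat (n choose l) * fact l * fact (m - l) * (- of_real (2 * r)) ^ l * coeff P l)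
           \<le> fact m"
  using assms(2-)
proof (induction n arbitrary: m P)
  case 0
  have "cmod (poly P 0) \<le> 1" using 0(3)[of 0] r by simp
  then show ?case by (simp add: norm_mult poly_0_coeff_0)
next
  case (Suc n)
  then obtain m' where m: "m = Suc m'" using Suc_le_D by blast
  define c :: complex where "c = - of_real (2 * r)"
  define Q where "Q = smult (of_nat m) P - [:-c, 1:] * pderiv P"
  \<comment> \<open>\<open>Q\<close> is \<open>m\<close> times the polar derivative. In it the leading terms cancel, so the degree drops.\<close>
  have coeffQ: "coeff Q k = (of_nat m - of_nat k) * coeff P k + c * of_nat (Suc k) * coeff P (Suc k)" for k
    by (cases k) (simp_all add: Q_def coeff_pderiv algebra_simps)
  have "degree Q \<le> m'"
  proof (rule degree_le, intro allI impI)
    fix i assume "m' < i"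
    then consider "i = m" | "m < i" unfolding m by linarith
    then show "coeff Q i = 0"
      using Suc.prems(2) by cases (simp_all add: coeffQ coeff_eq_0)
  qed
  define Q' where "Q' = smult (1 / of_nat m) Q"
  have "degree Q' \<le> m'" unfolding Q'_def using \<open>degree Q \<le> m'\<close> degree_smult_le order_trans by blast
  moreover have "cmod (poly Q' w) \<le> 1" if "cmod (w + of_real r) \<le> r" for w
  proof -
    have "poly Q' w = poly P w - (w + of_real (2 * r)) * poly (pderiv P) w / of_nat m"
      unfolding Q'_def Q_def c_def using m by (simp add: diff_divide_distrib add_divide_distrib algebra_simps flip: of_nat_Suc)
    then show ?thesis
      using polar_derivative_bounded[OF r Suc.prems(2) _ Suc.prems(3) that] m by simp
  qed
  ultimately have IH: "cmod (\<Sum>l\<le>n. of_nat (n choose l) * fact l * fact (m' - l) * c ^ l * coeff Q' l) \<le> fact m'"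
    using Suc.IH[of m' Q'] Suc.prems(1) m unfolding c_def by simp
  define f where "f l = fact l * fact (m - l) * c ^ l * coeff P l" for l
  \<comment> \<open>On suitably scaled coefficients, one polar derivative acts as \<open>f \<mapsto> (\<lambda>l. f l + f (l + 1))\<close>;
    iterating this produces the binomial coefficients.\<close>
  have step: "of_nat m * (fact l * fact (m' - l) * c ^ l * coeff Q' l) = f l + f (Suc l)" if "l \<le> n" for l
  proof -
    have "l \<le> m'" using that Suc.prems(1) m by simp
    then obtain d where d: "m' = l + d" using le_Suc_ex by blast
    have "of_nat m * coeff Q' l = coeff Q l" unfolding Q'_def using m by (simp del: of_nat_Suc)
    then have "of_nat m * (fact l * fact (m' - l) * c ^ l * coeff Q' l) = fact l * fact (m' - l) * c ^ l * coeff Q l"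
      by (simp add: algebra_simps)
    also have "\<dots> = f l + f (Suc l)"
      unfolding coeffQ f_def m d by (simp add: Suc_diff_le algebra_simps)
    finally show ?thesis .
  qed
  have "(\<Sum>l\<le>Suc n. of_nat (Suc n choose l) * f l)
      = (\<Sum>l\<le>n. of_nat (n choose l) * (f l + f (Suc l)))"
  proof -
    have "(\<Sum>l\<le>Suc n. of_nat (Suc n choose l) * f l)
        = f 0 + (\<Sum>l\<le>n. of_nat (n choose l) * f (Suc l)) + (\<Sum>l\<le>n. of_nat (n choose Suc l) * f (Suc l))"
      by (subst sum.atMost_Suc_shift) (simp add: sum.distrib algebra_simps)
    also have "f 0 + (\<Sum>l\<le>n. of_nat (n choose l) * f (Suc l)) + (\<Sum>l\<le>n. of_nat (n choose Suc l) * f (Suc l))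
        = (\<Sum>l\<le>n. of_nat (n choose l) * f (Suc l)) + (\<Sum>l\<le>Suc n. of_nat (n choose l) * f l)"
      unfolding sum.atMost_Suc_shift[of "\<lambda>l. of_nat (n choose l) * f l" n] by simp
    also have "\<dots> = (\<Sum>l\<le>n. of_nat (n choose l) * (f l + f (Suc l)))"
      by (simp add: sum.distrib algebra_simps)
    finally show ?thesis .
  qed
  also have "\<dots> = of_nat m * (\<Sum>l\<le>n. of_nat (n choose l) * fact l * fact (m' - l) * c ^ l * coeff Q' l)"
    unfolding sum_distrib_left by (rule sum.cong) (auto simp flip: step)
  finally have "cmod (\<Sum>l\<le>Suc n. of_nat (Suc n choose l) * f l) \<le> real m * fact m'"
    using IH by (simp add: norm_mult mult_left_mono)
  then show ?case unfolding f_def c_def m by (simp add: mult.assoc)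
qed

section \<open>The moment functional of the exponential weight\<close>

text \<open>
  This is the integral of \<open>p(t) exp (- t)\<close> over the nonnegative half-line; the coefficient form keeps
  everything algebraic, and positivity is recovered below without integration.
\<close>
definition exp_moment :: "real poly \<Rightarrow> real" where
  "exp_moment p = (\<Sum>k\<le>degree p. fact k * coeff p k)"

lemma exp_moment_eq:
  assumes "degree p \<le> N"
  shows "exp_moment p = (\<Sum>k\<le>N. fact k * coeff p k)"
  unfolding exp_moment_def using assms
  by (intro sum.mono_neutral_left) (auto simp: coeff_eq_0)

lemma exp_moment_0 [simp]: "exp_moment 0 = 0"
  by (simp add: exp_moment_def)

lemma exp_moment_add: "exp_moment (p + q) = exp_moment p + exp_moment q"
proof -
  define N where "N = max (degree p) (degree q)"
  have "degree (p + q) \<le> N" "degree p \<le> N" "degree q \<le> N"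
    by (auto simp: N_def degree_add_le_max)
  then show ?thesis
    by (simp add: exp_moment_eq[of _ N] sum.distrib algebra_simps)
qed

lemma exp_moment_smult: "exp_moment (smult c p) = c * exp_moment p"
  by (simp add: exp_moment_eq[OF degree_smult_le] exp_moment_def sum_distrib_left algebra_simps)

lemma exp_moment_sum: "exp_moment (sum f A) = (\<Sum>i\<in>A. exp_moment (f i))"
  by (induction A rule: infinite_finite_induct) (simp_all add: exp_moment_add)

lemma exp_moment_monom: "exp_moment (monom c k) = c * fact k"
  by (simp add: exp_moment_eq[OF degree_monom_le] sum.remove[of _ k])

text \<open>Integration by parts against \<open>exp (- t)\<close>.\<close>
lemma exp_moment_pderiv: "exp_moment (pderiv p) = exp_moment p - coeff p 0"
proof -
  have "exp_moment p = (\<Sum>k\<le>Suc (degree p). fact k * coeff p k)"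
    by (rule exp_moment_eq) simp
  also have "\<dots> = coeff p 0 + (\<Sum>k\<le>degree p. fact k * coeff (pderiv p) k)"
    by (subst sum.atMost_Suc_shift) (simp add: coeff_pderiv algebra_simps)
  also have "(\<Sum>k\<le>degree p. fact k * coeff (pderiv p) k) = exp_moment (pderiv p)"
    by (rule exp_moment_eq[symmetric]) (simp add: degree_pderiv)
  finally show ?thesis by simp
qed

lemma poly_div_exp_tendsto_0:
  fixes p :: "real poly"
  shows "((\<lambda>x. poly p x / exp x) \<longlongrightarrow> 0) at_top"
proof -
  have "((\<lambda>x. \<Sum>i\<le>degree p. coeff p i * (x ^ i / exp x)) \<longlongrightarrow> (\<Sum>i\<le>degree p. coeff p i * 0)) at_top"
    by (intro tendsto_intros tendsto_power_div_exp_0)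
  then show ?thesis
    by (simp add: poly_altdef sum_divide_distrib)
qed

text \<open>
  With \<open>S = p + p' + p'' + \<dots>\<close> one has \<open>S - S' = p\<close>, so \<open>S(x) exp (- x)\<close> is the tail integral of
  \<open>p(t) exp (- t)\<close> over \<open>t \<ge> x\<close>: its derivative is \<open>- p(x) exp (- x)\<close> and it tends to 0. Hence it
  decreases to 0 on the half-line, and \<open>S(0)\<close> is the moment. If the moment were 0, then \<open>S\<close> would
  vanish on the half-line and so would \<open>p\<close>.
\<close>
lemma exp_moment_pos:
  assumes "p \<noteq> 0" and nonneg: "\<And>x. 0 \<le> x \<Longrightarrow> 0 \<le> poly p x"
  shows "0 < exp_moment p"
proof -
  define S where "S = (\<Sum>k\<le>degree p. (pderiv ^^ k) p)"
  have last: "(pderiv ^^ Suc (degree p)) p = 0"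
    by (simp add: pderiv_eq_0_iff degree_higher_pderiv)
  have "pderiv S = (\<Sum>k\<le>degree p. (pderiv ^^ Suc k) p)"
    unfolding S_def using higher_pderiv_sum[of 1] by simp
  also have "\<dots> = (\<Sum>k\<le>Suc (degree p). (pderiv ^^ k) p) - p"
    by (subst sum.atMost_Suc_shift) simp
  also have "\<dots> = S - p"
    unfolding S_def using last by simp
  finally have S': "pderiv S = S - p" .
  have S0: "poly S 0 = exp_moment p"
    unfolding S_def exp_moment_def poly_sum
    by (rule sum.cong) (simp_all add: poly_0_coeff_0 coeff_higher_pderiv pochhammer_fact)
  define g where "g x = poly S x / exp x" for x
  have "(g has_real_derivative - (poly p x / exp x)) (at x)" for x
    unfolding g_def
    by (rule derivative_eq_intros poly_DERIV refl | simp add: S' field_simps)+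
  then have mono: "g y \<le> g x" if "0 \<le> x" "x \<le> y" for x y
    using that nonneg by (intro DERIV_nonpos_imp_nonincreasing[of x y g]) force+
  have gnonneg: "0 \<le> g x" if "0 \<le> x" for x
  proof (rule tendsto_upperbound)
    show "(g \<longlongrightarrow> 0) at_top" unfolding g_def by (rule poly_div_exp_tendsto_0)
    show "\<forall>\<^sub>F y in at_top. g y \<le> g x"
      using eventually_ge_at_top[of x] by eventually_elim (use mono that in auto)
  qed simp
  have g0: "g 0 = exp_moment p" by (simp add: g_def S0)
  show ?thesis
  proof (rule ccontr)
    assume "\<not> 0 < exp_moment p"
    then have "g x = 0" if "0 \<le> x" for x
      using mono[of 0 x] gnonneg[of x] g0 that by simp
    then have "{0..} \<subseteq> {x. poly S x = 0}" by (auto simp: g_def)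
    then have "S = 0"
      using poly_roots_finite[of S] infinite_Ici[of "0::real"] finite_subset by blast
    then show False using S' \<open>p \<noteq> 0\<close> by simp
  qed
qed

section \<open>Laguerre polynomials as shifted moments\<close>

definition shifted_moment :: "nat \<Rightarrow> nat \<Rightarrow> real \<Rightarrow> real" where
  "shifted_moment a n y = exp_moment ([:0, 1:] ^ a * [:y, -1:] ^ n)"

lemma shifted_moment_eq:
  "shifted_moment a n y = (\<Sum>l\<le>n. of_nat (n choose l) * (- 1) ^ (n - l) * fact (a + (n - l)) * y ^ l)"
proof -
  have "[:y, -1:] ^ n = ([:y:] + monom (- 1) 1) ^ n"
    by (simp add: monom_Suc monom_0)
  also have "\<dots> = (\<Sum>l\<le>n. smult (of_nat (n choose l) * y ^ l * (- 1) ^ (n - l)) (monom 1 (n - l)))"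
    unfolding binomial_ring
    by (rule sum.cong) (simp_all add: monom_power poly_const_pow smult_monom of_nat_poly)
  finally show ?thesis
    unfolding shifted_moment_def
    by (simp add: sum_distrib_left exp_moment_sum exp_moment_smult monom_altdef[symmetric, of 1, simplified]
        mult_monom exp_moment_monom algebra_simps)
qed

lemma shifted_moment_pos:
  assumes "even n"
  shows "0 < shifted_moment a n y"
  unfolding shifted_moment_def
proof (rule exp_moment_pos)
  show "0 \<le> poly ([:0, 1:] ^ a * [:y, - 1:] ^ n) x" if "0 \<le> x" for x
    using that assms by (simp add: zero_le_even_power)
qed simp

lemma shifted_moment_0: "shifted_moment a n 0 = (- 1) ^ n * fact (a + n)"
  unfolding shifted_moment_eq by (cases n) (simp_all add: sum.atMost_Suc_shift)

lemma DERIV_shifted_moment: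
  "(shifted_moment a (Suc n) has_real_derivative real (Suc n) * shifted_moment a n y) (at y)"
proof -
  have fn: "shifted_moment a (Suc n) = (\<lambda>y. (- 1) ^ Suc n * fact (a + Suc n)
      + (\<Sum>l\<le>n. of_nat (Suc n choose Suc l) * (- 1) ^ (n - l) * fact (a + (n - l)) * y ^ Suc l))"
    unfolding shifted_moment_eq by (subst sum.atMost_Suc_shift) simp
  have "(shifted_moment a (Suc n) has_real_derivative
      (\<Sum>l\<le>n. of_nat (Suc n choose Suc l) * (- 1) ^ (n - l) * fact (a + (n - l)) * (of_nat (Suc l) * y ^ l))) (at y)"
    unfolding fn
    by (auto intro!: derivative_eq_intros sum.cong simp: algebra_simps simp del: power_Suc binomial_Suc_Suc)
  also have "(\<Sum>l\<le>n. of_nat (Suc n choose Suc l) * (- 1) ^ (n - l) * fact (a + (n - l)) * (of_nat (Suc l) * y ^ l))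
      = real (Suc n) * shifted_moment a n y"
    unfolding shifted_moment_eq sum_distrib_left
  proof (rule sum.cong)
    fix l
    have "real (Suc l) * real (Suc n choose Suc l) = real (Suc n) * real (n choose l)"
      by (metis Suc_times_binomial of_nat_mult)
    then show "real (Suc n choose Suc l) * (- 1) ^ (n - l) * fact (a + (n - l)) * (real (Suc l) * y ^ l)
        = real (Suc n) * (real (n choose l) * (- 1) ^ (n - l) * fact (a + (n - l)) * y ^ l)"
      by (simp add: algebra_simps del: binomial_Suc_Suc of_nat_Suc)
  qed simp
  finally show ?thesis .
qed

lemma continuous_on_shifted_moment: "continuous_on A (shifted_moment a n)"
  unfolding shifted_moment_eq[abs_def] by (intro continuous_intros)

text \<open>
  Because \<open>n - m - 1\<close> is negative, negating the upper index turns the generalized binomial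
  coefficient of index \<open>n - l\<close> into \<open>(-1)\<^bsup>n - l\<^esup>\<close> times \<open>m - l\<close> choose \<open>n - l\<close>. The factor
  \<open>(m - l)!\<close> in it is the moment of \<open>t\<^bsup>m - l\<^esup>\<close>.
\<close>
lemma gen_laguerre_eq_shifted_moment:
  assumes "n \<le> m"
  shows "gen_laguerre n (- real m - 1) (- y) = shifted_moment (m - n) n y / (fact n * fact (m - n))"
proof -
  have "((real n + (- real m - 1)) gchoose (n - l)) * (y ^ l / fact l) =
      of_nat (n choose l) * (- 1) ^ (n - l) * fact (m - n + (n - l)) * y ^ l / (fact n * fact (m - n))"
    if "l \<le> n" for l
  proof -
    have eq: "m - n + (n - l) = m - l" "m - l - (n - l) = m - n" and le: "n - l \<le> m - l" "l \<le> m"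
      using that assms by auto
    have "(real n + (- real m - 1)) gchoose (n - l) = (- 1) ^ (n - l) * (real (m - l) gchoose (n - l))"
      using that le by (subst gbinomial_negated_upper) (simp add: of_nat_diff algebra_simps)
    also have "real (m - l) gchoose (n - l) = fact (m - l) / (fact (n - l) * fact (m - n))"
      using binomial_fact[OF le(1), where ?'a = real] by (simp only: binomial_gbinomial eq)
    finally show ?thesis
      unfolding eq(1) binomial_fact[OF that, where ?'a = real] by (simp add: mult_ac)
  qed
  then show ?thesis
    by (simp add: gen_laguerre_def shifted_moment_eq sum_divide_distrib)
qed

section \<open>The lower bound at twice the centre\<close>

text \<open>Obtained by integrating the derivative of \<open>t\<^bsup>a + 1\<^esup> (t - M)\<^bsup>j + 1\<^esup>\<close>, which vanishes at 0.\<close>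
lemma recenter_moment_recurrence:
  fixes M :: real
  defines "D \<equiv> \<lambda>a j. exp_moment ([:0, 1:] ^ a * [:-M, 1:] ^ j)"
  shows "D a (Suc (Suc j)) = (real a + 2 + real j - M) * D a (Suc j) + real (Suc j) * M * D a j"
proof -
  define t :: "real poly" where "t = [:0, 1:]"
  define s where "s = [:-M, 1:]"
  have t: "t = s + [:M:]" by (simp add: s_def t_def)
  have dt: "pderiv t = 1" and ds: "pderiv s = 1"
    by (simp_all add: t_def s_def pderiv_pCons)
  have c0: "coeff (t ^ Suc a * s ^ Suc j) 0 = 0"
    by (simp add: t_def flip: poly_0_coeff_0)
  have "pderiv (t ^ Suc a * s ^ Suc j)
      = smult (real (Suc a)) (t ^ a * s ^ Suc j) + smult (real (Suc j)) (t ^ a * (t * s ^ j))"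
    unfolding pderiv_mult pderiv_power_Suc dt ds by (simp add: algebra_simps)
  also have "t * s ^ j = s ^ Suc j + smult M (s ^ j)"
    by (subst t) (simp add: algebra_simps)
  finally have "exp_moment (pderiv (t ^ Suc a * s ^ Suc j))
      = real (Suc a) * D a (Suc j) + real (Suc j) * (D a (Suc j) + M * D a j)"
    by (simp add: D_def distrib_left exp_moment_add exp_moment_smult del: power_Suc flip: t_def s_def)
  moreover have "t ^ Suc a * s ^ Suc j = t ^ a * s ^ Suc (Suc j) + smult M (t ^ a * s ^ Suc j)"
    by (subst t, subst power_Suc, subst t[symmetric]) (simp add: algebra_simps)
  then have "exp_moment (t ^ Suc a * s ^ Suc j) = D a (Suc (Suc j)) + M * D a (Suc j)"
    by (simp add: D_def exp_moment_add exp_moment_smult del: power_Suc flip: t_def s_def)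
  ultimately show ?thesis
    using exp_moment_pderiv[of "t ^ Suc a * s ^ Suc j"] c0 by (simp add: algebra_simps del: power_Suc)
qed

text \<open>
  For the centre \<open>M = a + N\<close>, the recurrence expresses the moment of odd order \<open>j \<le> N\<close> through the one
  of order \<open>j - 1\<close>, which is positive and enters with the factor \<open>j - N \<le> 0\<close>, and the one of
  order \<open>j - 2\<close>, which is nonpositive by induction.
\<close>
lemma odd_recentered_moment_nonpos:
  assumes "2 * i + 1 \<le> N"
  shows "exp_moment ([:0, 1:] ^ a * [:- real (a + N), 1:] ^ (2 * i + 1)) \<le> 0"
  using assms
proof (induction i)
  case 0
  have "[:0, 1:] ^ a * [:- real (a + N), 1:] ^ 1 = monom 1 (Suc a) + smult (- real (a + N)) (monom 1 a)"
  proof -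
    have "[:- real (a + N), 1:] = [:0, 1:] + [:- real (a + N):]" by simp
    then show ?thesis unfolding monom_altdef by (simp only: power_one_right power_Suc distrib_left) simp
  qed
  then have "exp_moment ([:0, 1:] ^ a * [:- real (a + N), 1:] ^ 1) = (1 - real N) * fact a"
    by (simp add: exp_moment_add exp_moment_smult exp_moment_monom algebra_simps)
  then show ?case using 0 by (simp add: mult_nonpos_nonneg)
next
  case (Suc i)
  let ?D = "\<lambda>j. exp_moment ([:0, 1:] ^ a * [:- real (a + N), 1:] ^ j)"
  have "0 < ?D (2 * i + 2)"
    by (rule exp_moment_pos) (simp_all add: zero_le_even_power del: power_Suc)
  moreover have "?D (2 * i + 1) \<le> 0" using Suc by simp
  moreover have "?D (2 * Suc i + 1) = (real (2 * i + 3) - real N) * ?D (2 * i + 2)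
      + real (2 * i + 2) * real (a + N) * ?D (2 * i + 1)"
    using recenter_moment_recurrence[of a "real (a + N)" "2 * i + 1"]
    by (simp add: algebra_simps eval_nat_numeral)
  ultimately show ?case
    using Suc.prems by (simp add: add_nonpos_nonpos mult_nonpos_nonneg mult_nonneg_nonpos)
qed

text \<open>
  Substituting \<open>t = M + s\<close> with \<open>M = a + N\<close>, the two sides are the moments of \<open>t\<^sup>a (M + s)\<^sup>n\<close> and
  \<open>t\<^sup>a (M - s)\<^sup>n\<close>. Their binomial expansions differ only in the sign of the odd powers of \<open>s\<close>, whose
  moments are nonpositive. As \<open>N\<close> is odd, every odd \<open>j \<le> n\<close> satisfies \<open>j \<le> N\<close> also when
  \<open>n = N + 1\<close>.
\<close>
lemma shifted_moment_ge_fact: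
  assumes "n = N \<or> n = Suc N" and "odd N"
  shows "fact (a + n) \<le> shifted_moment a n (2 * real (a + N))"
proof -
  define M where "M = real (a + N)"
  define t s where "t = ([:0, 1:] :: real poly)" and "s = [:-M, 1:]"
  define D where "D j = exp_moment (t ^ a * s ^ j)" for j
  have D_odd: "D j \<le> 0" if "odd j" "j \<le> n" for j
  proof -
    obtain i where i: "j = 2 * i + 1" using \<open>odd j\<close> oddE by blast
    have "j \<le> N" using that assms by (cases "j = n") auto
    then show ?thesis
      using odd_recentered_moment_nonpos[of i N a] unfolding D_def t_def s_def M_def i by simp
  qed
  have t: "t = s + [:M:]" and y: "[:2 * M, -1:] = - s + [:M:]" by (simp_all add: s_def t_def)
  have expand: "exp_moment (t ^ a * (smult \<epsilon> s + [:M:]) ^ n)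
      = (\<Sum>j\<le>n. real (n choose j) * M ^ (n - j) * (\<epsilon> ^ j * D j))" for \<epsilon>
    unfolding binomial_ring sum_distrib_left exp_moment_sum
  proof (rule sum.cong)
    fix j
    have "t ^ a * (of_nat (n choose j) * smult \<epsilon> s ^ j * [:M:] ^ (n - j))
        = smult (real (n choose j) * M ^ (n - j) * \<epsilon> ^ j) (t ^ a * s ^ j)"
      by (simp add: smult_power poly_const_pow of_nat_poly algebra_simps)
    then show "exp_moment (t ^ a * (of_nat (n choose j) * smult \<epsilon> s ^ j * [:M:] ^ (n - j)))
        = real (n choose j) * M ^ (n - j) * (\<epsilon> ^ j * D j)"
      by (simp add: exp_moment_smult D_def)
  qed simp
  have "fact (a + n) = exp_moment (t ^ a * (smult 1 s + [:M:]) ^ n)"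
    using exp_moment_monom[of 1 "a + n"] by (simp add: monom_altdef power_add t_def flip: t)
  also have "\<dots> \<le> exp_moment (t ^ a * (smult (- 1) s + [:M:]) ^ n)"
    unfolding expand
  proof (rule sum_mono)
    fix j assume "j \<in> {..n}"
    then have "1 ^ j * D j \<le> (- 1) ^ j * D j"
      using D_odd[of j] by (cases "even j") auto
    then show "real (n choose j) * M ^ (n - j) * (1 ^ j * D j)
        \<le> real (n choose j) * M ^ (n - j) * ((- 1) ^ j * D j)"
      by (rule mult_left_mono) (simp add: M_def)
  qed
  also have "\<dots> = shifted_moment a n (2 * real (a + N))"
    unfolding shifted_moment_def M_def[symmetric] y by (simp add: t_def)
  finally show ?thesis .
qed

section \<open>Crossing the level \<open>m!\<close>\<close>

text \<open>
  The derivatives are, up to positive factors, shifted moments with smaller \<open>n\<close>, and those with even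
  \<open>n\<close> are positive. For odd \<open>n\<close> the function is therefore increasing. For even \<open>n\<close> its derivative is
  increasing; as the value at \<open>y\<close> is at least the value at 0, the derivative is nonnegative somewhere in
  between, hence positive beyond \<open>y\<close>.
\<close>
lemma shifted_moment_gt_beyond:
  assumes n: "0 < n" and y: "0 < y" "fact (a + n) \<le> shifted_moment a n y" and x: "y < x"
  shows "fact (a + n) < shifted_moment a n x"
proof -
  obtain k where k: "n = Suc k" using n gr0_implies_Suc by blast
  have incr: "shifted_moment a (Suc j) u < shifted_moment a (Suc j) v"
    if "u < v" "\<And>w. u < w \<Longrightarrow> w < v \<Longrightarrow> 0 < shifted_moment a j w" for u v j
    using that(1)
  proof (rule DERIV_pos_imp_increasing_open)
    fix w assume "u < w" "w < v"
    then have "0 < real (Suc j) * shifted_moment a j w" using that by simp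
    then show "\<exists>d. DERIV (shifted_moment a (Suc j)) w :> d \<and> 0 < d"
      using DERIV_shifted_moment by blast
  qed (rule continuous_on_shifted_moment)
  have "shifted_moment a n y < shifted_moment a n x"
  proof (cases "even k")
    case True
    then show ?thesis unfolding k using incr[OF x] shifted_moment_pos by blast
  next
    case False
    then obtain j where j: "k = Suc j" and "even j" by (cases k) auto
    obtain c where c: "0 < c" "c < y"
      and "shifted_moment a n y - shifted_moment a n 0 = (y - 0) * (real n * shifted_moment a k c)"
      using MVT2[OF y(1), of "shifted_moment a n" "\<lambda>u. real n * shifted_moment a k u"]
        DERIV_shifted_moment k by blast
    moreover have "shifted_moment a n 0 \<le> shifted_moment a n y"
      using y(2) k False by (simp add: shifted_moment_0)
    ultimately have "0 \<le> (y * real n) * shifted_moment a k c" by simp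
    then have c0: "0 \<le> shifted_moment a k c"
      using mult_pos_pos[OF y(1), of "real n"] n by (simp add: zero_le_mult_iff)
    show ?thesis unfolding k
    proof (rule incr[OF x])
      fix w assume "y < w"
      then have "c < w" using c by simp
      then have "shifted_moment a k c < shifted_moment a k w"
        unfolding j using incr shifted_moment_pos[OF \<open>even j\<close>] by blast
      then show "0 < shifted_moment a k w" using c0 by simp
    qed
  qed
  then show ?thesis using y(2) by simp
qed

text \<open>
  By the intermediate value theorem, it suffices to find a point of \<open>[0, 2M]\<close> where the value is below
  \<open>(a + n)!\<close>. For odd \<open>n\<close> the point 0 will do. For even \<open>n\<close> the value at 0 is exactly \<open>(a + n)!\<close>, but
  the derivative there is negative.
\<close>
lemma shifted_moment_eq_fact_exists:
  assumes "n = N \<or> n = Suc N" and "odd N"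
  shows "\<exists>y. 0 < y \<and> y \<le> 2 * real (a + N) \<and> shifted_moment a n y = fact (a + n)"
proof -
  have N: "0 < N" using assms(2) by (cases N) auto
  define M where "M = real (a + N)"
  have M: "0 < M" using N by (simp add: M_def)
  obtain x where x: "0 \<le> x" "x \<le> 2 * M" "shifted_moment a n x < fact (a + n)"
  proof (cases "even n")
    case True
    with assms N obtain k where k: "n = Suc k" "odd k" by (cases n) auto
    have "real n * shifted_moment a k 0 < 0"
      using k by (simp add: shifted_moment_0)
    then obtain d where d: "0 < d" "\<And>h. 0 < h \<Longrightarrow> h < d \<Longrightarrow> shifted_moment a n (0 + h) < shifted_moment a n 0"
      using DERIV_neg_dec_right[OF DERIV_shifted_moment[of a k 0]] k by auto
    define h where "h = min (d / 2) (2 * M)"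
    have "0 < h" "h < d" "h \<le> 2 * M" using d(1) M by (auto simp: h_def)
    then show ?thesis
      using that[of h] d(2)[of h] True by (simp add: shifted_moment_0)
  next
    case False
    then show ?thesis
      using that[of 0] M by (simp add: shifted_moment_0 less_trans[of _ 0])
  qed
  moreover have "fact (a + n) \<le> shifted_moment a n (2 * M)"
    unfolding M_def by (rule shifted_moment_ge_fact[OF assms])
  ultimately obtain y where "x \<le> y" "y \<le> 2 * M" "shifted_moment a n y = fact (a + n)"
    using IVT'[of "shifted_moment a n" x "fact (a + n)" "2 * M"] continuous_on_shifted_moment by force
  moreover from this x(3) have "y \<noteq> x" by auto
  ultimately have "0 < y \<and> y \<le> 2 * M \<and> shifted_moment a n y = fact (a + n)"
    using x(1) by simp
  then show ?thesis unfolding M_def by blast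
qed

section \<open>The bound on the stability radius\<close>

text \<open>
  The blossom at \<open>n\<close> copies of \<open>- 2r\<close> and \<open>m - n\<close> copies of 0 sees only the coefficients
  \<open>1 / l!\<close> with \<open>l \<le> n\<close>, which all members of the class share.
\<close>
lemma shifted_moment_le_fact_if_stable:
  assumes "n \<le> m" and P: "P \<in> Pi_class m n" and r: "0 < r"
    and sub: "stability_disk r \<subseteq> stability_region P"
  shows "shifted_moment (m - n) n (2 * r) \<le> fact m"
proof -
  obtain \<alpha> :: "nat \<Rightarrow> complex" where \<alpha>: "\<And>k. k \<le> n \<Longrightarrow> \<alpha> k = 1"
    and P_eq: "P = (\<Sum>k\<le>m. monom (\<alpha> k / fact k) k)"
    using P by (auto simp: Pi_class_def)
  have "degree P \<le> m"
    unfolding P_eq by (intro degree_sum_le) (auto intro: order_trans[OF degree_monom_le])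
  then have bound: "cmod (\<Sum>l\<le>n. of_nat (n choose l) * fact l * fact (m - l) * (- of_real (2 * r)) ^ l * coeff P l)
      \<le> fact m"
    using sub by (intro blossom_bounded[OF r \<open>n \<le> m\<close>]) (auto simp: stability_disk_def stability_region_def)
  have coeffP: "coeff P l = 1 / fact l" if "l \<le> n" for l
    using that \<alpha> \<open>n \<le> m\<close> by (simp add: P_eq coeff_sum)
  have "of_nat (n choose l) * fact l * fact (m - l) * (- of_real (2 * r)) ^ l * coeff P l
      = of_real ((- 1) ^ n * (real (n choose l) * (- 1) ^ (n - l) * fact (m - n + (n - l)) * (2 * r) ^ l))"
    if "l \<le> n" for l
  proof -
    have "m - n + (n - l) = m - l" using that \<open>n \<le> m\<close> by simp
    moreover have "(- 1) ^ n * (- 1) ^ (n - l) = (- 1 :: complex) ^ l"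
      using that by (metis le_add_diff_inverse2 left_minus_one_mult_self mult.commute mult.left_commute power_add)
    moreover have "(- of_real (2 * r)) ^ l = (- 1 :: complex) ^ l * of_real (2 * r) ^ l"
      by (rule power_minus)
    ultimately show ?thesis
      by (simp add: coeffP[OF that] mult_ac)
  qed
  then have "(\<Sum>l\<le>n. of_nat (n choose l) * fact l * fact (m - l) * (- of_real (2 * r)) ^ l * coeff P l)
      = complex_of_real ((- 1) ^ n * shifted_moment (m - n) n (2 * r))"
    unfolding shifted_moment_eq sum_distrib_left of_real_sum by (intro sum.cong) auto
  then have "\<bar>(- 1) ^ n * shifted_moment (m - n) n (2 * r)\<bar> \<le> fact m"
    using bound by (simp only: norm_of_real)
  then show ?thesis by (simp add: abs_mult)
qed

theorem theorem3:
  fixes m n :: nat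
  assumes "1 \<le> n" and "n \<le> m"
  shows "(\<exists>!\<xi>::real. \<xi> < 0 \<and> gen_laguerre n (- real m - 1) \<xi> - real (m choose n) = 0) \<and>
    (\<forall>\<xi>::real. \<xi> < 0 \<and> gen_laguerre n (- real m - 1) \<xi> - real (m choose n) = 0 \<longrightarrow>
       abs_stability_radius m n \<le> ereal (- \<xi> / 2) \<and>
       - \<xi> / 2 \<le> real m - (1 / 2) * (1 + (- 1) ^ n))"
proof -
  define a where "a = m - n"
  have m: "m = a + n" using assms(2) by (simp add: a_def)
  \<comment> \<open>The largest odd number up to \<open>n\<close>, so that \<open>a + N\<close> is the bound claimed for \<open>- \<xi> / 2\<close>.\<close>
  define N where "N = (if even n then n - 1 else n)"
  have N: "n = N \<or> n = Suc N" "odd N"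
    using assms(1) by (auto simp: N_def)
  have bound_eq: "real (a + N) = real m - (1 / 2) * (1 + (- 1) ^ n)"
    using assms(1) by (auto simp: N_def m of_nat_diff)
  have root_iff: "gen_laguerre n (- real m - 1) \<xi> - real (m choose n) = 0
      \<longleftrightarrow> shifted_moment a n (- \<xi>) = fact m" for \<xi>
    using gen_laguerre_eq_shifted_moment[OF assms(2), of "- \<xi>"]
      binomial_fact[OF assms(2), where ?'a = real]
    by (simp add: a_def)
  have beyond: "fact m < shifted_moment a n x" if "0 < y" "shifted_moment a n y = fact m" "y < x" for x y
    using shifted_moment_gt_beyond[of n y a x] that assms(1) by (simp add: m)
  obtain y where y: "0 < y" "y \<le> 2 * real (a + N)" "shifted_moment a n y = fact m"
    using shifted_moment_eq_fact_exists[OF N, of a] unfolding m by blast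
  have y_unique: "z = y" if "0 < z" "shifted_moment a n z = fact m" for z
    using beyond[OF that, of y] beyond[OF y(1,3), of z] y(3) that(2) by (cases y z rule: linorder_cases) auto
  have radius: "abs_stability_radius m n \<le> ereal (y / 2)"
    unfolding abs_stability_radius_def stability_radius_def
  proof (intro SUP_least)
    fix P r
    assume P: "P \<in> Pi_class m n"
      and "r \<in> {r. 0 \<le> r \<and> stability_disk r \<subseteq> stability_region P}"
    then have r: "0 \<le> r" "stability_disk r \<subseteq> stability_region P" by auto
    have "r \<le> y / 2"
    proof (rule ccontr)
      assume "\<not> r \<le> y / 2"
      then have "y < 2 * r" by simp
      moreover from this y(1) have "0 < r" by simp
      ultimately show False
        using beyond[OF y(1,3)] shifted_moment_le_fact_if_stable[OF assms(2) P _ r(2)]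
        unfolding a_def by fastforce
    qed
    then show "ereal r \<le> ereal (y / 2)" by simp
  qed
  show ?thesis
  proof (intro conjI allI impI)
    show "\<exists>!\<xi>. \<xi> < 0 \<and> gen_laguerre n (- real m - 1) \<xi> - real (m choose n) = 0"
      unfolding root_iff
    proof (rule ex1I)
      show "- y < 0 \<and> shifted_moment a n (- (- y)) = fact m" using y by simp
      show "\<xi> = - y" if "\<xi> < 0 \<and> shifted_moment a n (- \<xi>) = fact m" for \<xi>
        using y_unique[of "- \<xi>"] that by simp
    qed
  next
    fix \<xi> assume "\<xi> < 0 \<and> gen_laguerre n (- real m - 1) \<xi> - real (m choose n) = 0"
    then have \<xi>: "- \<xi> = y" using y_unique[of "- \<xi>"] by (simp only: root_iff) simp
    show "abs_stability_radius m n \<le> ereal (- \<xi> / 2)" using radius by (simp only: \<xi>)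
    show "- \<xi> / 2 \<le> real m - (1 / 2) * (1 + (- 1) ^ n)"
      unfolding \<xi> bound_eq[symmetric] using y(2) by simp
  qed
qed

end
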